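(* Suppose that $h$ is a strict CBF of $\mathcal{C}$, that $h(\mathbf{0}_n)>0$, that $\partial\mathcal{C}$ is bounded, and that the associated extended class $\mathcal{K}_\infty$ function is linear, i.e. $\alpha(z)=az$ for some $a>0$. Then for any compact set $\Phi\subset\mathbb{R}^n$ with $\partial\Phi\subset\mathcal{C}$ there exist $\tilde a_\Phi>0$ and a compact set $\tilde\Phi\supseteq\Phi$ such that, whenever the safety filter is defined with $\alpha(z)=az$ and $a>\tilde a_\Phi$, the set $\tilde\Phi$ is forward invariant under the filtered system $\dot{\mathbf{x}}=\tilde f(\mathbf{x})+g(\mathbf{x})v(\mathbf{x})$. As a consequence, any trajectory of this filtered system with initial condition in $\Phi\cap\mathcal{C}$ is bounded (it remains in $\tilde\Phi$ at all times).
   Context: Setting. $f:\mathbb{R}^n\to\mathbb{R}^n$, $g:\mathbb{R}^n\to\mathbb{R}^{n\times m}$ are locally Lipschitz and define $\dot{\mathbf{x}}=f(\mathbf{x})+g(\mathbf{x})\mathbf{u}$. A locally Lipschitz nominal controller $k:\mathbb{R}^n\to\mathbb{R}^m$ is given such that $\dot{\mathbf{x}}=\tilde f(\mathbf{x}):=f(\mathbf{x})+g(\mathbf{x})k(\mathbf{x})$ has the origin as its unique equilibrium, which is globally asymptotically stable. A function $\alpha:\mathbb{R}\to\mathbb{R}$ is of extended class $\mathcal{K}_\infty$ if it is (continuous and) strictly increasing, $\alpha(0)=0$ and $\lim_{s\to\pm\infty}\alpha(s)=\pm\infty$. Let $\mathcal{C}\subset\mathbb{R}^n$ and let $h:\mathbb{R}^n\to\mathbb{R}$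 be continuously differentiable with $\mathcal{C}=\{h\ge 0\}$ and $\partial\mathcal{C}=\{h=0\}$. $h$ is a strict control barrier function (strict CBF) of $\mathcal{C}$ with associated $\alpha$ if for every $\mathbf{x}\in\mathcal{C}$ there is $\mathbf{u}\in\mathbb{R}^m$ with $\nabla h(\mathbf{x})^\top(f(\mathbf{x})+g(\mathbf{x})\mathbf{u})+\alpha(h(\mathbf{x}))>0$. Filtered system: $\dot{\mathbf{x}}=\tilde f(\mathbf{x})+g(\mathbf{x})v(\mathbf{x})$, where the safety filter $v(\mathbf{x})$ is the unique minimizer of $\boldsymbol\theta^\top G(\mathbf{x})\boldsymbol\theta$ over $\boldsymbol\theta\in\mathbb{R}^m$ subject to $\nabla h(\mathbf{x})^\top(\tilde f(\mathbf{x})+g(\mathbf{x})\boldsymbol\theta)+\alpha(h(\mathbf{x}))\ge 0$; $G:\mathbb{R}^n\to\mathbb{R}^{m\times m}$ is continuously differentiable with positive definite values. $v$ is well defined and locally Lipschitz on $\mathcal{C}$, and $\mathcal{C}$ is forward invariant. The filtered system is studied on $\mathcal{C}$, so forward invariance of $\tilde\Phi$ refers to trajectories starting in $\tilde\Phi\cap\mathcal{C}$. *)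

theory Defs
  imports "HOL-Analysis.Analysis"
begin

text \<open>\<open>local_lipschitz\<close> is stated for time-dependent maps; an autonomous map ignores the
  time argument.\<close>

definition locally_lipschitz :: "('a::metric_space \<Rightarrow> 'b::metric_space) \<Rightarrow> bool" where
  "locally_lipschitz F \<longleftrightarrow> local_lipschitz (UNIV :: real set) UNIV (\<lambda>_. F)"

definition continuously_differentiable ::
    "('a::real_normed_vector \<Rightarrow> 'b::real_normed_vector) \<Rightarrow> bool" where
  "continuously_differentiable F \<longleftrightarrow>
     (\<exists>F' :: 'a \<Rightarrow> 'a \<Rightarrow>\<^sub>L 'b.
        (\<forall>x. (F has_derivative blinfun_apply (F' x)) (at x)) \<and> continuous_on UNIV F')"

definition grad :: "(real^'n \<Rightarrow> real) \<Rightarrow> real^'n \<Rightarrow> real^'n" where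
  "grad h x = (\<chi> i. frechet_derivative h (at x) (axis i 1))"

text \<open>Symmetry is not demanded, so symmetric positive definite matrices are a special case.\<close>

definition positive_definite :: "real^'m^'m \<Rightarrow> bool" where
  "positive_definite A \<longleftrightarrow> (\<forall>\<theta>. \<theta> \<noteq> 0 \<longrightarrow> 0 < \<theta> \<bullet> (A *v \<theta>))"

text \<open>A trajectory lives on an arbitrary interval \<open>I\<close> of nonnegative times starting at \<open>0\<close>,
  such as \<open>[0, T]\<close>, \<open>[0, T)\<close> or \<open>[0, \<infinity>)\<close>; in particular maximal solutions with finite escape
  time are covered. At \<open>0\<close> the derivative is one-sided.\<close>

definition trajectory_on ::
    "real set \<Rightarrow> ('a::real_normed_vector \<Rightarrow> 'a) \<Rightarrow> (real \<Rightarrow> 'a) \<Rightarrow> bool" where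
  "trajectory_on I F x \<longleftrightarrow>
     is_interval I \<and> 0 \<in> I \<and> I \<subseteq> {0..} \<and>
     (\<forall>t\<in>I. (x has_vector_derivative F (x t)) (at t within I))"

text \<open>Forward completeness is part of global asymptotic stability.\<close>

definition globally_asymptotically_stable ::
    "('a::real_normed_vector \<Rightarrow> 'a) \<Rightarrow> 'a \<Rightarrow> bool" where
  "globally_asymptotically_stable F p \<longleftrightarrow>
     (\<forall>x0. \<exists>x. trajectory_on {0..} F x \<and> x 0 = x0) \<and>
     (\<forall>\<epsilon>>0. \<exists>\<delta>>0. \<forall>x. trajectory_on {0..} F x \<and> dist (x 0) p < \<delta> \<longrightarrow>
        (\<forall>t\<ge>0. dist (x t) p < \<epsilon>)) \<and>
     (\<forall>x. trajectory_on {0..} F x \<longrightarrow> (x \<longlongrightarrow> p) at_top)"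

text \<open>Forward invariance of \<open>S\<close> for a system studied on \<open>C\<close>: only trajectories that start
  in \<open>S \<inter> C\<close> are considered.\<close>

definition forward_invariant_relative ::
    "'a set \<Rightarrow> ('a::real_normed_vector \<Rightarrow> 'a) \<Rightarrow> 'a set \<Rightarrow> bool" where
  "forward_invariant_relative C F S \<longleftrightarrow>
     (\<forall>I x. trajectory_on I F x \<and> x 0 \<in> S \<inter> C \<longrightarrow> (\<forall>t\<in>I. x t \<in> S))"

definition extended_class_K_inf :: "(real \<Rightarrow> real) \<Rightarrow> bool" where
  "extended_class_K_inf \<alpha> \<longleftrightarrow>
     continuous_on UNIV \<alpha> \<and> strict_mono \<alpha> \<and> \<alpha> 0 = 0 \<and>
     filterlim \<alpha> at_top at_top \<and> filterlim \<alpha> at_bot at_bot"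

definition strict_CBF ::
    "(real^'n \<Rightarrow> real^'n) \<Rightarrow> (real^'n \<Rightarrow> real^'m^'n) \<Rightarrow> (real^'n) set \<Rightarrow>
     (real^'n \<Rightarrow> real) \<Rightarrow> (real \<Rightarrow> real) \<Rightarrow> bool" where
  "strict_CBF f g C h \<alpha> \<longleftrightarrow>
     extended_class_K_inf \<alpha> \<and>
     (\<forall>x\<in>C. \<exists>u. grad h x \<bullet> (f x + g x *v u) + \<alpha> (h x) > 0)"

definition nominal_system ::
    "(real^'n \<Rightarrow> real^'n) \<Rightarrow> (real^'n \<Rightarrow> real^'m^'n) \<Rightarrow> (real^'n \<Rightarrow> real^'m) \<Rightarrow>
     real^'n \<Rightarrow> real^'n" where
  "nominal_system f g k x = f x + g x *v k x"

text \<open>The first argument of \<open>safety_filter\<close> is the nominal closed-loop vector field. The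
  minimizer exists and is unique wherever \<open>G x\<close> is positive definite and the constraint is
  feasible; where it is infeasible the value is unspecified.\<close>

definition safety_filter ::
    "(real^'n \<Rightarrow> real^'n) \<Rightarrow> (real^'n \<Rightarrow> real^'m^'n) \<Rightarrow> (real^'n \<Rightarrow> real) \<Rightarrow>
     (real \<Rightarrow> real) \<Rightarrow> (real^'n \<Rightarrow> real^'m^'m) \<Rightarrow> real^'n \<Rightarrow> real^'m" where
  "safety_filter F g h \<alpha> G x =
     (THE \<theta>. is_arg_min (\<lambda>\<theta>. \<theta> \<bullet> (G x *v \<theta>))
        (\<lambda>\<theta>. grad h x \<bullet> (F x + g x *v \<theta>) + \<alpha> (h x) \<ge> 0) \<theta>)"

definition filtered_system ::
    "(real^'n \<Rightarrow> real^'n) \<Rightarrow> (real^'n \<Rightarrow> real^'m^'n) \<Rightarrow> (real^'n \<Rightarrow> real) \<Rightarrow>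
     (real \<Rightarrow> real) \<Rightarrow> (real^'n \<Rightarrow> real^'m^'m) \<Rightarrow> real^'n \<Rightarrow> real^'n" where
  "filtered_system F g h \<alpha> G x = F x + g x *v safety_filter F g h \<alpha> G x"

end

theory Submission
  imports Defs
begin

text \<open>No Lyapunov function is needed. Choose \<open>R\<close> such that \<open>\<Phi>\<close> and the frontier of \<open>C\<close> lie
  in the open ball of radius \<open>R\<close>, and let \<open>\<Psi>\<close> be the closure of the set of points that the
  nominal system reaches from the closed ball of radius \<open>R\<close>. Global asymptotic stability,
  continuous dependence on initial data and compactness of the ball make \<open>\<Psi>\<close> bounded, and
  \<open>\<Psi>\<close> is invariant under the nominal system. On the part of \<open>C\<close> outside the open ball and
  within a compact neighbourhood of \<open>\<Psi>\<close>, the function \<open>h\<close> has a positive minimum, so for large \<open>a\<close> the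
  input \<open>0\<close> satisfies the constraint there and the filter is inactive. A filtered trajectory leaving
  \<open>\<Psi>\<close> would therefore follow the nominal system just after its exit time, which is impossible.\<close>

section \<open>Lipschitz constants of the nominal field on compact sets\<close>

lemma bounded_bilinear_matrix_vector_mult:
  "bounded_bilinear ((*v) :: real^'m^'n \<Rightarrow> real^'m \<Rightarrow> real^'n)"
  unfolding bilinear_conv_bounded_bilinear [symmetric] bilinear_def
  by (auto intro!: linearI simp: algebra_simps scaleR_matrix_vector_assoc)

text \<open>As in the product rule, the intermediate term \<open>pr (a x) (b y)\<close> splits the
  difference into one increment of each factor; compactness bounds the other factor. It serves for
  the term \<open>g x *v k x\<close> of the closed loop.\<close>

lemma lipschitz_on_bounded_bilinear:
  assumes "bounded_bilinear pr" and a: "A-lipschitz_on K a" and b: "B-lipschitz_on K b"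
    and "compact K"
  shows "\<exists>L. L-lipschitz_on K (\<lambda>x. pr (a x) (b x))"
proof -
  interpret bounded_bilinear pr by fact
  obtain P where P: "P > 0" "\<And>u v. norm (pr u v) \<le> norm u * norm v * P"
    using pos_bounded by blast
  have "bounded (a ` K)" "bounded (b ` K)"
    using a b \<open>compact K\<close>
    by (meson compact_imp_bounded compact_continuous_image lipschitz_on_continuous_on)+
  then obtain MA MB where M: "MA > 0" "\<And>x. x \<in> K \<Longrightarrow> norm (a x) \<le> MA"
    "MB > 0" "\<And>x. x \<in> K \<Longrightarrow> norm (b x) \<le> MB"
    unfolding bounded_pos by (metis imageI)
  have A: "A \<ge> 0" and B: "B \<ge> 0"
    using a b lipschitz_on_nonneg by auto
  have "((MA * B + A * MB) * P)-lipschitz_on K (\<lambda>x. pr (a x) (b x))"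
  proof (rule lipschitz_onI)
    fix x y assume K: "x \<in> K" "y \<in> K"
    have "pr (a x) (b x) - pr (a y) (b y) = pr (a x) (b x - b y) + pr (a x - a y) (b y)"
      by (simp add: diff_left diff_right)
    then have "dist (pr (a x) (b x)) (pr (a y) (b y))
        \<le> norm (pr (a x) (b x - b y)) + norm (pr (a x - a y) (b y))"
      by (metis dist_norm norm_triangle_ineq)
    also have "\<dots> \<le> norm (a x) * norm (b x - b y) * P + norm (a x - a y) * norm (b y) * P"
      by (intro add_mono P)
    also have "\<dots> \<le> MA * (B * dist x y) * P + (A * dist x y) * MB * P"
    proof (intro add_mono)
      show "norm (a x) * norm (b x - b y) * P \<le> MA * (B * dist x y) * P"
        using lipschitz_onD[OF b K] M(1,2) K P(1)
        by (intro mult_right_mono mult_mono) (auto simp: dist_norm)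
      show "norm (a x - a y) * norm (b y) * P \<le> (A * dist x y) * MB * P"
        using lipschitz_onD[OF a K] M(3,4) K P(1) A
        by (intro mult_right_mono mult_mono) (auto simp: dist_norm)
    qed
    finally show "dist (pr (a x) (b x)) (pr (a y) (b y)) \<le> (MA * B + A * MB) * P * dist x y"
      by (simp add: algebra_simps)
  qed (use A B M P in auto)
  then show ?thesis by blast
qed

lemma locally_lipschitz_imp_lipschitz_on_compact:
  assumes "locally_lipschitz F" "compact K"
  obtains L where "L-lipschitz_on K F"
proof -
  \<comment> \<open>Time is restricted to one point because a uniform constant requires compactness
    in time as well as in space.\<close>
  have "local_lipschitz {0::real} K (\<lambda>_. F)"
    using assms(1) unfolding locally_lipschitz_def by (rule local_lipschitz_subset) auto
  from local_lipschitz_compact_implies_lipschitz[OF this \<open>compact K\<close>]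
  obtain L where "L-lipschitz_on K F" by (auto simp: continuous_on_const)
  then show ?thesis by (rule that)
qed

lemma nominal_system_lipschitz_on_compact:
  assumes "locally_lipschitz f" "locally_lipschitz g" "locally_lipschitz k" "compact K"
  shows "\<exists>L. L-lipschitz_on K (nominal_system f g k)"
proof -
  obtain Lf Lg Lk where L: "Lf-lipschitz_on K f" "Lg-lipschitz_on K g" "Lk-lipschitz_on K k"
    using assms locally_lipschitz_imp_lipschitz_on_compact by metis
  obtain M where "M-lipschitz_on K (\<lambda>x. g x *v k x)"
    using lipschitz_on_bounded_bilinear[OF bounded_bilinear_matrix_vector_mult L(2,3) assms(4)] by auto
  then have "(Lf + M)-lipschitz_on K (\<lambda>x. f x + g x *v k x)"
    using L(1) lipschitz_on_add by blast
  then show ?thesis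
    unfolding nominal_system_def by blast
qed

lemma lipschitz_on_compacts_imp_continuous:
  fixes F :: "'a::euclidean_space \<Rightarrow> 'b::metric_space"
  assumes "\<And>K. compact K \<Longrightarrow> \<exists>L. L-lipschitz_on K F"
  shows "continuous_on UNIV F"
proof -
  have "continuous (at x) F" for x
  proof -
    obtain L where "L-lipschitz_on (cball x 1) F"
      using assms[OF compact_cball] by blast
    then have "continuous_on (cball x 1) F"
      by (rule lipschitz_on_continuous_on)
    then show ?thesis
      by (rule continuous_on_interior) (simp add: interior_cball)
  qed
  then show ?thesis
    by (simp add: continuous_at_imp_continuous_on)
qed

section \<open>Restricting, shifting and comparing trajectories\<close>

lemma trajectory_on_continuous:
  "trajectory_on I F x \<Longrightarrow> continuous_on I x"
  unfolding trajectory_on_def continuous_on_eq_continuous_within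
  by (auto dest: has_vector_derivative_continuous)

text \<open>Besides moving the initial time to \<open>s\<close>, this exchanges the vector field. A
  piece of filtered trajectory on which the filter is inactive thereby becomes a nominal
  trajectory.\<close>

lemma trajectory_on_segment:
  assumes "trajectory_on I F x" "s \<in> I" "t \<in> I" "0 \<le> s"
    and eq: "\<And>r. s \<le> r \<Longrightarrow> r \<le> t \<Longrightarrow> F (x r) = H (x r)" and "s \<le> t"
  shows "trajectory_on {0..t - s} H (\<lambda>r. x (s + r))"
proof -
  have I: "is_interval I" using assms(1) unfolding trajectory_on_def by blast
  have sub: "(+) s ` {0..t - s} \<subseteq> I"
  proof
    fix p assume "p \<in> (+) s ` {0..t - s}"
    then have "s \<le> p" "p \<le> t" by auto
    then show "p \<in> I" using I assms(2,3) unfolding is_interval_1 by blast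
  qed
  have "((\<lambda>r. x (s + r)) has_vector_derivative H (x (s + r))) (at r within {0..t - s})"
    if r: "r \<in> {0..t - s}" for r
  proof -
    have 1: "((+) s has_vector_derivative 1) (at r within {0..t - s})"
      using has_derivative_add[OF has_derivative_const has_derivative_ident]
      by (simp add: has_vector_derivative_def)
    have "s + r \<in> I" using sub r by auto
    then have "(x has_vector_derivative F (x (s + r))) (at (s + r) within (+) s ` {0..t - s})"
      using assms(1) sub unfolding trajectory_on_def
      by (metis has_vector_derivative_within_subset)
    from vector_diff_chain_within[OF 1 this] show ?thesis
      using eq[of "s + r"] r by (simp add: o_def)
  qed
  then show ?thesis
    using assms(6) by (auto simp: trajectory_on_def is_interval_cc)
qed

lemma trajectory_on_shift:
  assumes "trajectory_on {0..} F x" "0 \<le> s"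
  shows "trajectory_on {0..} F (\<lambda>r. x (s + r))"
proof -
  have "((\<lambda>r. x (s + r)) has_vector_derivative F (x (s + r))) (at r within {0..})"
    if r: "r \<in> {0..}" for r
  proof -
    have 1: "((+) s has_vector_derivative 1) (at r within {0..})"
      using has_derivative_add[OF has_derivative_const has_derivative_ident]
      by (simp add: has_vector_derivative_def)
    have "(x has_vector_derivative F (x (s + r))) (at (s + r) within (+) s ` {0..})"
    proof (rule has_vector_derivative_within_subset)
      show "(x has_vector_derivative F (x (s + r))) (at (s + r) within {0..})"
        using assms r unfolding trajectory_on_def by auto
    qed (use assms in auto)
    from vector_diff_chain_within[OF 1 this] show ?thesis
      by (simp add: o_def)
  qed
  then show ?thesis
    by (auto simp: trajectory_on_def is_interval_ci)
qed

lemma trajectory_on_subset: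
  assumes "trajectory_on I F x" "J \<subseteq> I" "is_interval J" "0 \<in> J"
  shows "trajectory_on J F x"
proof -
  have "(x has_vector_derivative F (x t)) (at t within J)" if "t \<in> J" for t
    using assms(1,2) that unfolding trajectory_on_def
    by (metis has_vector_derivative_within_subset subsetD)
  then show ?thesis
    using assms by (auto simp: trajectory_on_def)
qed

text \<open>Supplies the two-sided derivatives that the monotonicity arguments for \<open>w\<close>
  and \<open>h\<close> need.\<close>

lemma trajectory_derivative_interior:
  assumes "trajectory_on I F x" "a \<in> I" "b \<in> I" "a < t" "t < b"
  shows "(x has_vector_derivative F (x t)) (at t)"
proof -
  have I: "is_interval I" using assms(1) unfolding trajectory_on_def by blast
  have "{a<..<b} \<subseteq> I"
  proof
    fix p assume "p \<in> {a<..<b}"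
    then have "a \<le> p" "p \<le> b" by auto
    then show "p \<in> I" using I assms(2,3) unfolding is_interval_1 by blast
  qed
  moreover have "t \<in> {a<..<b}" using assms by auto
  ultimately have "(x has_vector_derivative F (x t)) (at t within {a<..<b})"
    using assms(1) unfolding trajectory_on_def
    by (metis has_vector_derivative_within_subset subsetD)
  then show ?thesis
    using at_within_open[OF \<open>t \<in> {a<..<b}\<close> open_greaterThanLessThan] by simp
qed

text \<open>Gronwall's argument applied to \<open>exp (- 2 L t) * |x - y|\<^sup>2\<close>; the Lipschitz bound is
  only available while \<open>y\<close> is \<open>e\<close>-close to \<open>x\<close>, whence the first exit time.\<close>

lemma trajectories_close:
  fixes x y :: "real \<Rightarrow> 'a::real_inner"
  assumes x: "trajectory_on {0..T} F x" and y: "trajectory_on {0..T} F y"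
    and L: "L-lipschitz_on K F" and K: "\<And>t. t \<in> {0..T} \<Longrightarrow> cball (x t) e \<subseteq> K"
    and small: "dist (x 0) (y 0) * exp (L * T) < e" and t: "t \<in> {0..T}"
  shows "dist (x t) (y t) \<le> dist (x 0) (y 0) * exp (L * T)"
proof -
  define w where "w t = ((x t - y t) \<bullet> (x t - y t)) * exp (- 2 * L * t)" for t
  have L0: "0 \<le> L" using L lipschitz_on_nonneg by auto
  have cx: "continuous_on {0..T} x" and cy: "continuous_on {0..T} y"
    using x y trajectory_on_continuous by auto
  \<comment> \<open>Closeness is required only strictly before \<open>s\<close>, so the estimate
    also applies at the first exit time.\<close>
  have est: "dist (x s) (y s) \<le> dist (x 0) (y 0) * exp (L * T)"
    if s: "0 \<le> s" "s \<le> T" and close: "\<And>r. 0 < r \<Longrightarrow> r < s \<Longrightarrow> dist (x r) (y r) \<le> e" for s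
  proof -
    have "w s \<le> w 0"
    proof (rule DERIV_nonpos_imp_decreasing_open[OF s(1)])
      fix r assume r: "0 < r" "r < s"
      have dx: "(x has_vector_derivative F (x r)) (at r)" "(y has_vector_derivative F (y r)) (at r)"
        using trajectory_derivative_interior[OF x, of 0 T r]
          trajectory_derivative_interior[OF y, of 0 T r] r s by auto
      have "((\<lambda>t. x t - y t) has_vector_derivative (F (x r) - F (y r))) (at r)"
        by (intro derivative_intros dx)
      then have d: "((\<lambda>t. x t - y t) has_derivative (\<lambda>h. h *\<^sub>R (F (x r) - F (y r)))) (at r)"
        by (simp add: has_vector_derivative_def)
      let ?D = "(2 * ((x r - y r) \<bullet> (F (x r) - F (y r))) - 2 * L * ((x r - y r) \<bullet> (x r - y r)))
          * exp (- 2 * L * r)"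
      have "((\<lambda>t. (x t - y t) \<bullet> (x t - y t)) has_real_derivative
          2 * ((x r - y r) \<bullet> (F (x r) - F (y r)))) (at r)"
        unfolding has_field_derivative_def
        by (rule has_derivative_eq_rhs[OF has_derivative_inner[OF d d]])
          (auto simp: fun_eq_iff inner_commute)
      moreover have "((\<lambda>t. exp (- 2 * L * t)) has_real_derivative
          exp (- 2 * L * r) * (- 2 * L)) (at r)"
        by (rule derivative_eq_intros refl | simp)+
      ultimately have "(w has_real_derivative ?D) (at r)"
        unfolding w_def by (rule DERIV_cong[OF DERIV_mult]) (simp add: algebra_simps)
      moreover have "?D \<le> 0"
      proof -
        have "cball (x r) e \<subseteq> K" "dist (x r) (y r) \<le> e" "0 \<le> e"
          using K[of r] close[OF r] r s order_trans[OF zero_le_dist close[OF r]] by auto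
        then have "x r \<in> K" "y r \<in> K"
          by (auto simp: subset_iff)
        then have "norm (F (x r) - F (y r)) \<le> L * norm (x r - y r)"
          using lipschitz_onD[OF L] by (simp add: dist_norm)
        then have "(x r - y r) \<bullet> (F (x r) - F (y r)) \<le> norm (x r - y r) * (L * norm (x r - y r))"
          by (meson mult_left_mono norm_cauchy_schwarz norm_ge_zero order_trans)
        then show ?thesis
          by (intro mult_nonpos_nonneg) (auto simp: dot_square_norm power2_eq_square algebra_simps)
      qed
      ultimately show "\<exists>D. (w has_real_derivative D) (at r) \<and> D \<le> 0" by blast
    next
      show "continuous_on {0..s} w"
        unfolding w_def using s
        by (intro continuous_intros continuous_on_subset[OF cx] continuous_on_subset[OF cy]) auto
    qed
    then have "(dist (x s) (y s))\<^sup>2 * exp (- 2 * L * s) \<le> (dist (x 0) (y 0))\<^sup>2"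
      by (simp add: w_def dot_square_norm dist_norm)
    then have "(dist (x s) (y s))\<^sup>2 * exp (- 2 * L * s) * exp (2 * L * s)
        \<le> (dist (x 0) (y 0))\<^sup>2 * exp (2 * L * s)"
      by (intro mult_right_mono) auto
    then have "(dist (x s) (y s))\<^sup>2 \<le> (dist (x 0) (y 0))\<^sup>2 * exp (2 * L * s)"
      by (simp add: mult.assoc flip: exp_add)
    also have "\<dots> = (dist (x 0) (y 0) * exp (L * s))\<^sup>2"
      using exp_double[of "L * s"] by (simp add: power_mult_distrib mult.assoc)
    finally have "dist (x s) (y s) \<le> dist (x 0) (y 0) * exp (L * s)"
      by (rule power2_le_imp_le) simp
    also have "\<dots> \<le> dist (x 0) (y 0) * exp (L * T)"
      using s L0 by (intro mult_left_mono) (auto intro: mult_left_mono)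
    finally show ?thesis .
  qed
  \<comment> \<open>At \<open>Inf S\<close>, which lies in \<open>S\<close> by closedness, the
    distance would be at least \<open>e\<close>, while \<open>est\<close> and \<open>small\<close>
    make it less than \<open>e\<close>.\<close>
  define S where "S = {t \<in> {0..T}. e \<le> dist (x t) (y t)}"
  have "S = {}"
  proof (rule ccontr)
    assume "S \<noteq> {}"
    have "closed S"
    proof -
      have "closed ({0..T} \<inter> (\<lambda>t. dist (x t) (y t)) -` {e..})"
        by (intro continuous_closed_preimage continuous_intros cx cy)
      moreover have "{0..T} \<inter> (\<lambda>t. dist (x t) (y t)) -` {e..} = S"
        by (auto simp: S_def)
      ultimately show ?thesis by simp
    qed
    have bdd: "bdd_below S" by (auto simp: S_def)
    have "Inf S \<in> S"
      using closed_contains_Inf[OF \<open>S \<noteq> {}\<close> bdd \<open>closed S\<close>] .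
    moreover have "dist (x (Inf S)) (y (Inf S)) \<le> dist (x 0) (y 0) * exp (L * T)"
    proof (rule est)
      fix r assume "0 < r" "r < Inf S"
      then have "r \<notin> S" using cInf_lower[OF _ bdd] by force
      then show "dist (x r) (y r) \<le> e"
        using \<open>0 < r\<close> \<open>r < Inf S\<close> \<open>Inf S \<in> S\<close> by (auto simp: S_def)
    qed (use \<open>Inf S \<in> S\<close> in \<open>auto simp: S_def\<close>)
    ultimately show False
      using small by (auto simp: S_def)
  qed
  have "dist (x r) (y r) \<le> e" if "0 < r" "r < t" for r
  proof -
    have "r \<notin> S" using \<open>S = {}\<close> by simp
    then show ?thesis using that t by (simp add: S_def)
  qed
  with t show ?thesis
    by (intro est) auto
qed

lemma continuous_dependence:
  fixes F :: "'a::euclidean_space \<Rightarrow> 'a"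
  assumes lip: "\<And>K. compact K \<Longrightarrow> \<exists>L. L-lipschitz_on K F"
    and x: "trajectory_on {0..T} F x" and "0 < \<epsilon>"
  shows "\<exists>\<delta>>0. \<forall>y. trajectory_on {0..T} F y \<and> dist (x 0) (y 0) < \<delta> \<longrightarrow>
    (\<forall>t\<in>{0..T}. dist (x t) (y t) < \<epsilon>)"
proof -
  have "compact (x ` {0..T})"
    using trajectory_on_continuous[OF x] by (intro compact_continuous_image) auto
  \<comment> \<open>The Minkowski sum of the curve and a ball is a compact set containing the whole
    tube around \<open>x\<close>, so one Lipschitz constant covers the tube.\<close>
  then have "compact {p + q | p q. p \<in> x ` {0..T} \<and> q \<in> cball 0 \<epsilon>}" (is "compact ?K")
    by (intro compact_sums) auto
  then obtain L where L: "L-lipschitz_on ?K F" using lip by blast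
  have K: "cball (x t) \<epsilon> \<subseteq> ?K" if "t \<in> {0..T}" for t
  proof
    fix p assume "p \<in> cball (x t) \<epsilon>"
    then have "p = x t + (p - x t)" "p - x t \<in> cball 0 \<epsilon>"
      by (auto simp: dist_norm norm_minus_commute)
    then show "p \<in> ?K" using that by blast
  qed
  show ?thesis
  proof (intro exI[of _ "\<epsilon> * exp (- (L * T))"] conjI allI impI ballI)
    fix y t
    assume y: "trajectory_on {0..T} F y \<and> dist (x 0) (y 0) < \<epsilon> * exp (- (L * T))"
      and t: "t \<in> {0..T}"
    then have small: "dist (x 0) (y 0) * exp (L * T) < \<epsilon>"
      by (simp add: exp_minus field_simps)
    have "dist (x t) (y t) \<le> dist (x 0) (y 0) * exp (L * T)"
      using y by (intro trajectories_close[where x = x and y = y, OF x _ L K small t]) auto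
    then show "dist (x t) (y t) < \<epsilon>"
      using small by simp
  qed (use \<open>0 < \<epsilon>\<close> in auto)
qed

section \<open>Reachable sets of a globally asymptotically stable system\<close>

definition reachable_set :: "('a::real_normed_vector \<Rightarrow> 'a) \<Rightarrow> 'a set \<Rightarrow> 'a set" where
  "reachable_set F S = {x t | x t. trajectory_on {0..} F x \<and> x 0 \<in> S \<and> 0 \<le> t}"

text \<open>The trajectory from a point \<open>q\<close> comes close to \<open>p\<close> by some
  time \<open>T\<close>. Trajectories from a neighbourhood of \<open>q\<close> follow it up to
  \<open>T\<close>, and stability confines them to the unit ball around \<open>p\<close> afterwards.
  Finitely many such neighbourhoods cover \<open>K\<close>.\<close>

lemma bounded_reachable_set:
  fixes F :: "'a::euclidean_space \<Rightarrow> 'a"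
  assumes lip: "\<And>K. compact K \<Longrightarrow> \<exists>L. L-lipschitz_on K F"
    and gas: "globally_asymptotically_stable F p" and "compact K"
  shows "bounded (reachable_set F K)"
proof -
  obtain \<delta> where \<delta>: "\<delta> > 0"
    "\<And>x t. trajectory_on {0..} F x \<Longrightarrow> dist (x 0) p < \<delta> \<Longrightarrow> 0 \<le> t \<Longrightarrow> dist (x t) p < 1"
    using gas unfolding globally_asymptotically_stable_def by (metis zero_less_one)
  have "\<exists>U. open U \<and> q \<in> U \<and> bounded (reachable_set F U)" for q
  proof -
    obtain x where x: "trajectory_on {0..} F x" "x 0 = q" and lim: "(x \<longlongrightarrow> p) at_top"
      using gas unfolding globally_asymptotically_stable_def by metis
    \<comment> \<open>Half of \<delta> is reserved for the deviation of neighbouring trajectories,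
      so that they too are within \<delta> of \<open>p\<close> at time \<open>T\<close>.\<close>
    have "\<forall>\<^sub>F t in at_top. dist (x t) p < \<delta> / 2"
      using lim half_gt_zero[OF \<delta>(1)] unfolding tendsto_iff by blast
    then obtain T where T: "0 \<le> T" "dist (x T) p < \<delta> / 2"
      unfolding eventually_at_top_linorder by (meson max.cobounded1 max.cobounded2)
    have xT: "trajectory_on {0..T} F x"
      using x(1) T(1) by (auto intro: trajectory_on_subset simp: is_interval_cc)
    obtain \<eta> where \<eta>: "\<eta> > 0" "\<And>y t. trajectory_on {0..T} F y \<Longrightarrow> dist (x 0) (y 0) < \<eta> \<Longrightarrow>
      t \<in> {0..T} \<Longrightarrow> dist (x t) (y t) < \<delta> / 2"
      using continuous_dependence[OF lip xT, of "\<delta> / 2"] \<delta>(1) by auto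
    have "compact (x ` {0..T})"
      using trajectory_on_continuous[OF xT] by (intro compact_continuous_image) auto
    then have "bounded (x ` {0..T})" by (rule compact_imp_bounded)
    then obtain B where B': "\<forall>z\<in>x ` {0..T}. norm z \<le> B"
      unfolding bounded_iff by (rule exE)
    have B: "norm (x t) \<le> B" if "t \<in> {0..T}" for t
      using bspec[OF B' imageI[OF that]] .
    \<comment> \<open>The first bound serves for times up to \<open>T\<close>, the second for later
      ones.\<close>
    have "norm (y t) \<le> max (B + \<delta>) (norm p + 1)"
      if y: "trajectory_on {0..} F y" "y 0 \<in> ball q \<eta>" "0 \<le> t" for y t
    proof -
      have yT: "trajectory_on {0..T} F y"
        using y(1) T(1) by (auto intro: trajectory_on_subset simp: is_interval_cc)
      have close: "dist (x s) (y s) < \<delta> / 2" if "s \<in> {0..T}" for s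
        using \<eta>(2)[OF yT _ that] y(2) x(2) by auto
      show ?thesis
      proof (cases "t \<le> T")
        case True
        have "norm (y t) \<le> norm (x t) + dist (x t) (y t)"
          by (metis dist_commute dist_norm norm_triangle_sub)
        then show ?thesis
          using B[of t] close[of t] True y(3) \<delta>(1) by auto
      next
        case False
        have "dist (y T) p \<le> dist (x T) (y T) + dist (x T) p"
          by (metis dist_commute dist_triangle)
        then have "dist (y T) p < \<delta>"
          using close[of T] T by auto
        then have "dist (y (T + (t - T))) p < 1"
          using \<delta>(2)[OF trajectory_on_shift[OF y(1) T(1)], of "t - T"] False by simp
        then show ?thesis
          using norm_triangle_sub[of "y t" p] by (simp add: dist_norm)
      qed
    qed
    then have "bounded (reachable_set F (ball q \<eta>))"
      unfolding bounded_iff reachable_set_def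
      by (intro exI[of _ "max (B + \<delta>) (norm p + 1)"]) auto
    then show ?thesis
      using \<eta>(1) by (intro exI[of _ "ball q \<eta>"]) auto
  qed
  then obtain U where U: "\<And>q. open (U q)" "\<And>q. q \<in> U q" "\<And>q. bounded (reachable_set F (U q))"
    by metis
  obtain D where D: "D \<subseteq> K" "finite D" "K \<subseteq> (\<Union>q\<in>D. U q)"
    using compactE_image[OF \<open>compact K\<close>, of K U] U by (metis UN_I subsetI)
  have "reachable_set F K \<subseteq> (\<Union>q\<in>D. reachable_set F (U q))"
    using D(3) by (force simp: reachable_set_def)
  moreover have "bounded (\<Union>q\<in>D. reachable_set F (U q))"
    using D(2) U(3) by (simp add: bounded_UN)
  ultimately show ?thesis
    by (rule bounded_subset[rotated])
qed

lemma subset_reachable_set: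
  assumes "globally_asymptotically_stable F p"
  shows "S \<subseteq> reachable_set F S"
proof
  fix q assume "q \<in> S"
  then obtain x where "trajectory_on {0..} F x" "x 0 = q"
    using assms unfolding globally_asymptotically_stable_def by blast
  then show "q \<in> reachable_set F S"
    using \<open>q \<in> S\<close> unfolding reachable_set_def by force
qed

text \<open>A point near \<open>x 0\<close> is reached by some complete trajectory \<open>z\<close>;
  following \<open>z\<close> for a further time \<open>T\<close> stays in the reachable set and, by
  continuous dependence, ends near \<open>x T\<close>.\<close>

lemma closure_reachable_set_invariant:
  fixes F :: "'a::euclidean_space \<Rightarrow> 'a"
  assumes lip: "\<And>K. compact K \<Longrightarrow> \<exists>L. L-lipschitz_on K F"
    and x: "trajectory_on {0..T} F x" and x0: "x 0 \<in> closure (reachable_set F S)"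
    and "0 \<le> T"
  shows "x T \<in> closure (reachable_set F S)"
  unfolding closure_approachable
proof (intro allI impI)
  fix \<epsilon> :: real assume "0 < \<epsilon>"
  obtain \<delta> where \<delta>: "\<delta> > 0" "\<And>y. trajectory_on {0..T} F y \<Longrightarrow> dist (x 0) (y 0) < \<delta> \<Longrightarrow>
      dist (x T) (y T) < \<epsilon>"
    using continuous_dependence[OF lip x \<open>0 < \<epsilon>\<close>] \<open>0 \<le> T\<close> by auto
  obtain q where "q \<in> reachable_set F S" "dist q (x 0) < \<delta>"
    using x0 \<delta>(1) unfolding closure_approachable by blast
  then obtain z s where z: "trajectory_on {0..} F z" "z 0 \<in> S" "0 \<le> s" "dist (x 0) (z s) < \<delta>"
    by (auto simp: reachable_set_def dist_commute)
  have "trajectory_on {0..T} F (\<lambda>r. z (s + r))"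
    by (rule trajectory_on_subset[OF trajectory_on_shift[OF z(1,3)]])
      (use \<open>0 \<le> T\<close> in \<open>auto simp: is_interval_cc\<close>)
  then have "dist (x T) (z (s + T)) < \<epsilon>"
    using \<delta>(2) z(4) by fastforce
  moreover have "z (s + T) \<in> reachable_set F S"
    using z \<open>0 \<le> T\<close> by (force simp: reachable_set_def)
  ultimately show "\<exists>q\<in>reachable_set F S. dist q (x T) < \<epsilon>"
    by (metis dist_commute)
qed

section \<open>Last exit times and short stays in open sets\<close>

lemma exists_last_time_in_closed:
  fixes x :: "real \<Rightarrow> 'a::metric_space"
  assumes cont: "continuous_on {0..b} x" and "closed S" and "x 0 \<in> S" and "x b \<notin> S" and "0 \<le> b"
  obtains s where "0 \<le> s" "s < b" "x s \<in> S" "\<And>t. s < t \<Longrightarrow> t \<le> b \<Longrightarrow> x t \<notin> S"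
proof -
  let ?A = "{0..b} \<inter> x -` S"
  have cl: "closed ?A"
    by (rule continuous_closed_preimage[OF cont _ \<open>closed S\<close>]) simp
  have ne: "?A \<noteq> {}" and bdd: "bdd_above ?A"
    using assms by auto
  have "Sup ?A \<in> ?A"
    by (rule closed_contains_Sup[OF ne bdd cl])
  moreover have "x t \<notin> S" if "Sup ?A < t" "t \<le> b" for t
  proof
    assume "x t \<in> S"
    then have "t \<in> ?A" using that \<open>Sup ?A \<in> ?A\<close> by auto
    then show False using cSup_upper[OF _ bdd] that(1) by fastforce
  qed
  moreover have "Sup ?A \<noteq> b"
    using \<open>Sup ?A \<in> ?A\<close> \<open>x b \<notin> S\<close> by auto
  ultimately show ?thesis
    using that[of "Sup ?A"] by auto
qed

lemma continuous_stays_in_open: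
  fixes x :: "real \<Rightarrow> 'a::metric_space"
  assumes cont: "continuous_on {a..b} x" and "a < b" and "open U" and "x a \<in> U"
  obtains c where "a < c" "c \<le> b" "\<And>t. a \<le> t \<Longrightarrow> t \<le> c \<Longrightarrow> x t \<in> U"
proof -
  obtain e where e: "e > 0" "ball (x a) e \<subseteq> U"
    using \<open>open U\<close> \<open>x a \<in> U\<close> open_contains_ball by blast
  obtain d where d: "d > 0" "\<And>t. t \<in> {a..b} \<Longrightarrow> dist t a < d \<Longrightarrow> dist (x t) (x a) < e"
    using cont \<open>a < b\<close> e(1) unfolding continuous_on_iff by (metis atLeastAtMost_iff less_imp_le order_refl)
  show ?thesis
  proof (rule that[of "min b (a + d / 2)"])
    fix t assume t: "a \<le> t" "t \<le> min b (a + d / 2)"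
    then have "dist (x t) (x a) < e"
      using d by (intro d(2)) (auto simp: dist_real_def)
    then show "x t \<in> U" using e(2) by (auto simp: dist_commute)
  qed (use \<open>a < b\<close> d(1) in auto)
qed

section \<open>The gradient and the quadratic program of the safety filter\<close>

text \<open>The entries of \<open>grad\<close> are the derivative on the basis vectors, so linearity
  recovers the derivative in every direction.\<close>

lemma continuously_differentiable_grad:
  fixes h :: "real^'n \<Rightarrow> real"
  assumes "continuously_differentiable h"
  shows "(h has_derivative (\<lambda>v. grad h x \<bullet> v)) (at x)" and "continuous_on UNIV (grad h)"
proof -
  obtain h' where h': "\<And>x. (h has_derivative blinfun_apply (h' x)) (at x)" and cont: "continuous_on UNIV h'"
    using assms unfolding continuously_differentiable_def by blast
  have grad: "grad h x = (\<chi> i. blinfun_apply (h' x) (axis i 1))" for x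
    unfolding grad_def using frechet_derivative_at[OF h'] by simp
  have "grad h x \<bullet> v = blinfun_apply (h' x) v" for v
  proof -
    have "blinfun_apply (h' x) v = blinfun_apply (h' x) (\<Sum>i\<in>UNIV. v $ i *\<^sub>R axis i 1)"
      using basis_expansion[of v] by (simp add: scalar_mult_eq_scaleR)
    also have "\<dots> = (\<Sum>i\<in>UNIV. v $ i * blinfun_apply (h' x) (axis i 1))"
      by (simp add: blinfun.sum_right blinfun.scaleR_right)
    finally show ?thesis
      by (simp add: grad inner_vec_def mult.commute)
  qed
  then show "(h has_derivative (\<lambda>v. grad h x \<bullet> v)) (at x)"
    using h'[of x] by (metis (no_types, lifting) ext)
  show "continuous_on UNIV (grad h)"
    unfolding grad using cont by (intro continuous_intros)
qed

text \<open>The parallelogram identity makes a definite quadratic form strictly convex, which gives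
  uniqueness; coercivity gives existence.\<close>

lemma positive_definite_minimizer:
  fixes A :: "real^'m^'m"
  assumes pd: "positive_definite A" and S: "closed S" "convex S" "S \<noteq> {}"
  shows "\<exists>!\<theta>. is_arg_min (\<lambda>\<theta>. \<theta> \<bullet> (A *v \<theta>)) (\<lambda>\<theta>. \<theta> \<in> S) \<theta>"
proof -
  define q where "q = (\<lambda>\<theta>. \<theta> \<bullet> (A *v \<theta>))"
  have cont: "continuous_on T q" for T
    unfolding q_def
    by (intro continuous_on_inner continuous_on_id
        bounded_linear.continuous_on[OF matrix_vector_mul_bounded_linear])
  have scale: "q (c *\<^sub>R \<theta>) = c\<^sup>2 * q \<theta>" for c \<theta>
    by (simp add: q_def matrix_vector_mult_scaleR power2_eq_square)
  have pos: "\<theta> \<noteq> 0 \<Longrightarrow> 0 < q \<theta>" for \<theta>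
    using pd by (simp add: positive_definite_def q_def)
  have "sphere 0 1 \<noteq> ({} :: (real^'m) set)"
    by simp
  \<comment> \<open>The minimum of \<open>q\<close> on the unit sphere becomes the coercivity
    constant, by homogeneity of degree two.\<close>
  then obtain \<omega> where \<omega>: "\<omega> \<in> sphere 0 1" "\<And>\<theta>. \<theta> \<in> sphere 0 1 \<Longrightarrow> q \<omega> \<le> q \<theta>"
    using continuous_attains_inf[OF compact_sphere _ cont] by blast
  have "0 < q \<omega>" using \<omega>(1) by (intro pos) auto
  have coercive: "q \<omega> * (norm \<theta>)\<^sup>2 \<le> q \<theta>" for \<theta>
  proof (cases "\<theta> = 0")
    case False
    have "\<theta> = norm \<theta> *\<^sub>R ((1 / norm \<theta>) *\<^sub>R \<theta>)"
      using False by simp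
    then have "q \<theta> = (norm \<theta>)\<^sup>2 * q ((1 / norm \<theta>) *\<^sub>R \<theta>)"
      by (metis scale)
    moreover have "q \<omega> \<le> q ((1 / norm \<theta>) *\<^sub>R \<theta>)"
      using False by (intro \<omega>(2)) auto
    ultimately show ?thesis
      by (metis mult.commute mult_left_mono zero_le_power2)
  qed (simp add: q_def)
  obtain \<theta>0 where "\<theta>0 \<in> S" using S by blast
  \<comment> \<open>Cutting the feasible set at the level of one feasible point leaves a compact set
    with the same minimizers.\<close>
  let ?K = "S \<inter> {\<theta>. q \<theta> \<le> q \<theta>0}"
  have "closed ?K"
    using S(1) cont by (intro closed_Int closed_Collect_le) auto
  moreover have "bounded ?K"
  proof -
    have "norm \<theta> \<le> sqrt (q \<theta>0 / q \<omega>)" if "\<theta> \<in> ?K" for \<theta>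
    proof (rule real_le_rsqrt)
      show "(norm \<theta>)\<^sup>2 \<le> q \<theta>0 / q \<omega>"
        using coercive[of \<theta>] that \<open>0 < q \<omega>\<close> by (simp add: field_simps)
    qed
    then show ?thesis unfolding bounded_iff by blast
  qed
  ultimately have "compact ?K"
    by (simp add: compact_eq_bounded_closed)
  moreover have "?K \<noteq> {}" using \<open>\<theta>0 \<in> S\<close> by auto
  ultimately obtain \<theta> where \<theta>: "\<theta> \<in> ?K" "\<And>\<eta>. \<eta> \<in> ?K \<Longrightarrow> q \<theta> \<le> q \<eta>"
    using continuous_attains_inf[OF _ _ cont] by metis
  have min: "q \<theta> \<le> q \<eta>" if "\<eta> \<in> S" for \<eta>
    using \<theta>(1) \<theta>(2)[of \<eta>] that by fastforce
  \<comment> \<open>The mixed terms \<open>a \<bullet> (A *v b)\<close> and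
    \<open>b \<bullet> (A *v a)\<close> each cancel separately.\<close>
  have para: "q (a + b) + q (a - b) = 2 * q a + 2 * q b" for a b
    by (simp add: q_def matrix_vector_right_distrib matrix_vector_mult_diff_distrib inner_simps)
  show ?thesis
    unfolding q_def [symmetric]
  proof (rule ex1I)
    show "is_arg_min q (\<lambda>\<theta>. \<theta> \<in> S) \<theta>"
      using \<theta>(1) min by (auto simp: is_arg_min_def not_less)
    fix \<eta> assume \<eta>: "is_arg_min q (\<lambda>\<theta>. \<theta> \<in> S) \<eta>"
    then have "\<eta> \<in> S" "q \<eta> \<le> q \<theta>"
      using \<theta>(1) by (auto simp: is_arg_min_def not_less)
    \<comment> \<open>The midpoint is feasible, so its value is at least the minimum; the
      parallelogram identity then leaves no room for a positive
      \<open>q (\<eta> - \<theta>)\<close>.\<close>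
    have "(1 / 2) *\<^sub>R \<eta> + (1 / 2) *\<^sub>R \<theta> \<in> S"
      using S(2) \<open>\<eta> \<in> S\<close> \<theta>(1) by (intro convexD) auto
    then have "q \<theta> \<le> q ((1 / 2) *\<^sub>R (\<eta> + \<theta>))"
      using min by (simp add: scaleR_right_distrib)
    then have "q (\<eta> - \<theta>) \<le> 0"
      using para[of \<eta> \<theta>] \<open>q \<eta> \<le> q \<theta>\<close> by (simp add: scale power2_eq_square)
    then show "\<eta> = \<theta>"
      using pos[of "\<eta> - \<theta>"] by force
  qed
qed

text \<open>The constraint is affine in \<theta>, hence closed and convex, and \<open>u\<close>
  shows that it can be met. So the description in \<open>safety_filter\<close> denotes an actual
  minimizer, which satisfies the constraint.\<close>

lemma safety_filter_feasible:
  fixes g :: "real^'n \<Rightarrow> real^'m^'n"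
  assumes "positive_definite (G x)" and "0 \<le> grad h x \<bullet> (F x + g x *v u) + \<alpha> (h x)"
  shows "0 \<le> grad h x \<bullet> filtered_system F g h \<alpha> G x + \<alpha> (h x)"
proof -
  let ?S = "{\<theta>. 0 \<le> grad h x \<bullet> (F x + g x *v \<theta>) + \<alpha> (h x)}"
  have eq: "?S = {\<theta>. (transpose (g x) *v grad h x) \<bullet> \<theta> \<ge> - (grad h x \<bullet> F x + \<alpha> (h x))}"
    by (auto simp: inner_add_right dot_lmul_matrix)
  have "closed ?S" "convex ?S"
    unfolding eq by (rule closed_halfspace_ge, rule convex_halfspace_ge)
  moreover have "?S \<noteq> {}" using assms(2) by blast
  ultimately have "\<exists>!\<theta>. is_arg_min (\<lambda>\<theta>. \<theta> \<bullet> (G x *v \<theta>)) (\<lambda>\<theta>. \<theta> \<in> ?S) \<theta>"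
    by (rule positive_definite_minimizer[OF assms(1)])
  then have "is_arg_min (\<lambda>\<theta>. \<theta> \<bullet> (G x *v \<theta>)) (\<lambda>\<theta>. \<theta> \<in> ?S) (safety_filter F g h \<alpha> G x)"
    unfolding safety_filter_def mem_Collect_eq by (rule theI')
  then show ?thesis
    by (simp add: is_arg_min_def filtered_system_def)
qed

text \<open>If the zero input is feasible, it is the only minimizer, since every other input has
  positive cost.\<close>

lemma filtered_system_eq_nominal:
  assumes pd: "positive_definite (G x)" and "0 \<le> grad h x \<bullet> F x + \<alpha> (h x)"
  shows "filtered_system F g h \<alpha> G x = F x"
proof -
  have "safety_filter F g h \<alpha> G x = 0"
    unfolding safety_filter_def
  proof (rule the_equality)
    have "0 \<le> \<theta> \<bullet> (G x *v \<theta>)" for \<theta>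
      using pd by (cases "\<theta> = 0") (auto simp: positive_definite_def less_imp_le)
    then show "is_arg_min (\<lambda>\<theta>. \<theta> \<bullet> (G x *v \<theta>))
        (\<lambda>\<theta>. grad h x \<bullet> (F x + g x *v \<theta>) + \<alpha> (h x) \<ge> 0) 0"
      using assms(2) by (simp add: is_arg_min_def not_less)
  next
    fix \<theta> assume "is_arg_min (\<lambda>\<theta>. \<theta> \<bullet> (G x *v \<theta>))
        (\<lambda>\<theta>. grad h x \<bullet> (F x + g x *v \<theta>) + \<alpha> (h x) \<ge> 0) \<theta>"
    then have "\<not> 0 < \<theta> \<bullet> (G x *v \<theta>)"
      using assms(2) unfolding is_arg_min_def by (auto dest: spec[of _ 0])
    then show "\<theta> = 0"
      using pd by (auto simp: positive_definite_def)
  qed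
  then show ?thesis
    by (simp add: filtered_system_def)
qed

section \<open>Forward invariance of the safe set\<close>

text \<open>Strictness makes the constraint feasible on a neighbourhood of \<open>C\<close>, where
  \<open>h' \<ge> - a h\<close> pushes trajectories back towards \<open>C\<close>; without it nothing would be known about
  the filter at points just outside \<open>C\<close>.\<close>

lemma safe_set_invariant:
  fixes g :: "real^'n \<Rightarrow> real^'m^'n"
  assumes h: "continuously_differentiable h" and F: "continuous_on UNIV F"
    and g: "continuous_on UNIV g" and pd: "\<And>x. positive_definite (G x)" and "0 < a"
    and strict: "\<And>x. 0 \<le> h x \<Longrightarrow> \<exists>u. 0 < grad h x \<bullet> (F x + g x *v u) + a * h x"
    and x: "trajectory_on I (filtered_system F g h (\<lambda>z. a * z) G) x" and x0: "0 \<le> h (x 0)"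
    and t: "t \<in> I"
  shows "0 \<le> h (x t)"
proof (rule ccontr)
  let ?S = "filtered_system F g h (\<lambda>z. a * z) G"
  assume neg: "\<not> 0 \<le> h (x t)"
  have I: "0 \<in> I" "is_interval I" "0 \<le> t"
    using x t unfolding trajectory_on_def by auto
  have sub: "{0..t} \<subseteq> I"
    using I(1,2) t unfolding is_interval_1 by (meson atLeastAtMost_iff subsetI)
  have hd: "(h has_derivative (\<lambda>v. grad h y \<bullet> v)) (at y)" for y
    using continuously_differentiable_grad(1)[OF h] .
  have ch: "continuous_on UNIV h"
    using hd by (metis continuous_at_imp_continuous_on has_derivative_continuous)
  have cg: "continuous_on UNIV (grad h)"
    using continuously_differentiable_grad(2)[OF h] .
  have cx: "continuous_on {0..t} x"
    using trajectory_on_continuous[OF x] sub continuous_on_subset by blast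
  have "closed {y. 0 \<le> h y}"
    using ch by (intro closed_Collect_le) auto
  moreover have "x 0 \<in> {y. 0 \<le> h y}" "x t \<notin> {y. 0 \<le> h y}"
    using x0 neg by auto
  ultimately obtain s where s: "0 \<le> s" "s < t" "x s \<in> {y. 0 \<le> h y}"
    and out': "\<And>r. s < r \<Longrightarrow> r \<le> t \<Longrightarrow> x r \<notin> {y. 0 \<le> h y}"
    using exists_last_time_in_closed[OF cx _ _ _ I(3)] by metis
  have hs: "0 \<le> h (x s)" using s(3) by simp
  have out: "h (x r) < 0" if "s < r" "r \<le> t" for r
    using out'[OF that] by simp
  obtain u where u: "0 < grad h (x s) \<bullet> (F (x s) + g (x s) *v u) + a * h (x s)"
    using strict[OF hs] by blast
  \<comment> \<open>The input chosen at \<open>x s\<close> remains feasible on an open set, so the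
    filter obeys its constraint along \<open>x\<close> for a short time after
    \<open>s\<close>.\<close>
  define U where "U = {y. 0 < grad h y \<bullet> (F y + g y *v u) + a * h y}"
  have "open U"
    unfolding U_def
    by (intro open_Collect_less continuous_intros cg F g ch
        bounded_bilinear.continuous_on[OF bounded_bilinear_matrix_vector_mult])
  moreover have "x s \<in> U" using u by (simp add: U_def)
  moreover have "continuous_on {s..t} x"
    using cx s by (auto intro: continuous_on_subset)
  ultimately obtain c where c: "s < c" "c \<le> t" "\<And>r. s \<le> r \<Longrightarrow> r \<le> c \<Longrightarrow> x r \<in> U"
    using continuous_stays_in_open[OF _ s(2)] by metis
  \<comment> \<open>Just after \<open>s\<close> the value of \<open>h\<close> is negative, so the
    constraint forces a nonnegative derivative; \<open>h\<close> cannot descend from a nonnegative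
    value to a negative one.\<close>
  have "h (x s) \<le> h (x c)"
  proof (rule DERIV_nonneg_imp_increasing_open[where f = "\<lambda>r. h (x r)"])
    fix r assume r: "s < r" "r < c"
    have "(x has_vector_derivative ?S (x r)) (at r)"
      using trajectory_derivative_interior[OF x I(1) t] r s c by auto
    then have "((\<lambda>r. h (x r)) has_derivative (\<lambda>v. grad h (x r) \<bullet> (v *\<^sub>R ?S (x r)))) (at r)"
      using has_derivative_compose[OF _ hd] unfolding has_vector_derivative_def by blast
    then have "((\<lambda>r. h (x r)) has_real_derivative grad h (x r) \<bullet> ?S (x r)) (at r)"
      by (simp add: has_field_derivative_def mult_commute_abs)
    moreover have "0 \<le> grad h (x r) \<bullet> ?S (x r) + a * h (x r)"
      using c(3)[of r] r by (intro safety_filter_feasible[where u = u]) (auto simp: pd U_def)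
    moreover have "a * h (x r) \<le> 0"
      using out[of r] r c \<open>0 < a\<close> by (simp add: mult_nonneg_nonpos)
    ultimately show "\<exists>y. ((\<lambda>r. h (x r)) has_real_derivative y) (at r) \<and> 0 \<le> y"
      by fastforce
  next
    show "continuous_on {s..c} (\<lambda>r. h (x r))"
      using s c by (intro continuous_on_compose2[OF ch] continuous_on_subset[OF cx]) auto
  qed (use c in auto)
  then show False
    using out[of c] c hs by simp
qed

section \<open>Choice of the compact set and of the threshold\<close>

theorem proposition4p2:
  fixes f :: "real^'n \<Rightarrow> real^'n"
    and g :: "real^'n \<Rightarrow> real^'m^'n"
    and k :: "real^'n \<Rightarrow> real^'m"
    and h :: "real^'n \<Rightarrow> real"
    and G :: "real^'n \<Rightarrow> real^'m^'m"
    and C :: "(real^'n) set"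
    and \<alpha> :: "real \<Rightarrow> real"
  defines "F \<equiv> nominal_system f g k"
  assumes "locally_lipschitz f" and "locally_lipschitz g" and "locally_lipschitz k"
    and "\<And>x. F x = 0 \<longleftrightarrow> x = 0"
    and "globally_asymptotically_stable F 0"
    and "continuously_differentiable h"
    and "C = {x. h x \<ge> 0}" and "frontier C = {x. h x = 0}"
    and "continuously_differentiable G" and "\<And>x. positive_definite (G x)"
    and "strict_CBF f g C h \<alpha>"
    and "\<exists>a>0. \<alpha> = (\<lambda>z. a * z)"
    and "h 0 > 0"
    and "bounded (frontier C)"
  shows "\<forall>\<Phi>. compact \<Phi> \<and> frontier \<Phi> \<subseteq> C \<longrightarrow>
    (\<exists>a\<^sub>\<Phi>>0. \<exists>\<Psi>. compact \<Psi> \<and> \<Phi> \<subseteq> \<Psi> \<and>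
      (\<forall>a>a\<^sub>\<Phi>.
         forward_invariant_relative C (filtered_system F g h (\<lambda>z. a * z) G) \<Psi> \<and>
         (\<forall>I x. trajectory_on I (filtered_system F g h (\<lambda>z. a * z) G) x \<and> x 0 \<in> \<Phi> \<inter> C \<longrightarrow>
            bounded (x ` I) \<and> x ` I \<subseteq> \<Psi>)))"
proof (intro allI impI)
  fix \<Phi> :: "(real^'n) set"
  assume "compact \<Phi> \<and> frontier \<Phi> \<subseteq> C"
  then have "compact \<Phi>" by blast
  have lip: "\<exists>L. L-lipschitz_on K F" if "compact K" for K
    unfolding F_def using assms(2-4) that by (rule nominal_system_lipschitz_on_compact)
  have cF: "continuous_on UNIV F"
    using lip by (rule lipschitz_on_compacts_imp_continuous)
  have cg: "continuous_on UNIV g"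
    using assms(3) by (intro lipschitz_on_compacts_imp_continuous)
      (metis locally_lipschitz_imp_lipschitz_on_compact)
  have cgrad: "continuous_on UNIV (grad h)"
    using continuously_differentiable_grad(2)[OF assms(7)] .
  have ch: "continuous_on UNIV h"
    using continuously_differentiable_grad(1)[OF assms(7)]
    by (metis continuous_at_imp_continuous_on has_derivative_continuous)
  obtain a0 where a0: "0 < a0" "\<alpha> = (\<lambda>z. a0 * z)"
    using assms(13) by blast
  obtain R where R: "\<Phi> \<union> frontier C \<subseteq> ball 0 R"
    using bounded_subset_ballD[of "\<Phi> \<union> frontier C" 0] \<open>compact \<Phi>\<close> assms(15)
    by (auto simp: compact_imp_bounded)
  define \<Psi> where "\<Psi> = closure (reachable_set F (cball 0 R))"
  have "bounded (reachable_set F (cball 0 R))"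
    using lip assms(6) compact_cball by (rule bounded_reachable_set)
  then have "compact \<Psi>"
    by (simp add: \<Psi>_def compact_closure)
  have ball\<Psi>: "cball 0 R \<subseteq> \<Psi>"
    unfolding \<Psi>_def using subset_reachable_set[OF assms(6)] closure_subset by blast
  \<comment> \<open>The open ball of radius \<open>R'\<close> leaves a margin around \<Psi>, so a
    trajectory that has just left \<Psi> is still in the compact set \<open>A\<close> below.\<close>
  obtain R' where R': "\<Psi> \<subseteq> ball 0 R'"
    using bounded_subset_ballD[OF compact_imp_bounded[OF \<open>compact \<Psi>\<close>], of 0] by blast
  define A where "A = cball 0 R' \<inter> - ball 0 R \<inter> C"
  have "closed C"
    unfolding assms(8) using ch by (intro closed_Collect_le) auto
  then have "compact A"
    unfolding A_def by (intro compact_Int_closed) auto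
  have hpos: "0 < h y" if "y \<in> A" for y
  proof -
    have "y \<notin> frontier C" using that R by (auto simp: A_def)
    then show ?thesis using that assms(9) by (auto simp: A_def assms(8) less_le)
  qed
  \<comment> \<open>This quotient is the smallest gain \<open>a\<close> for which the zero input
    meets the constraint at \<open>y\<close>; \<open>M\<close> bounds it on
    \<open>A\<close>.\<close>
  have "continuous_on A (\<lambda>y. - (grad h y \<bullet> F y) / h y)"
    using hpos by (intro continuous_intros continuous_on_subset[OF cgrad]
        continuous_on_subset[OF cF] continuous_on_subset[OF ch]) force+
  then have "bounded ((\<lambda>y. - (grad h y \<bullet> F y) / h y) ` A)"
    using \<open>compact A\<close> compact_continuous_image compact_imp_bounded by blast
  then obtain M where M': "\<forall>z\<in>(\<lambda>y. - (grad h y \<bullet> F y) / h y) ` A. \<bar>z\<bar> \<le> M"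
    unfolding bounded_real by (rule exE)
  have M: "- (grad h y \<bullet> F y) / h y \<le> M" if "y \<in> A" for y
    using bspec[OF M' imageI[OF that]] by (rule abs_le_D1)
  \<comment> \<open>Exceeding \<open>a0\<close> keeps the strict CBF inequality, exceeding
    \<open>M\<close> switches the filter off on \<open>A\<close>; \<open>a0\<close> also makes the
    threshold positive.\<close>
  have inv: "x ` I \<subseteq> \<Psi>"
    if a: "max a0 M < a" and x: "trajectory_on I (filtered_system F g h (\<lambda>z. a * z) G) x"
      and x0: "x 0 \<in> \<Psi> \<inter> C" for a I x
  proof (rule image_subsetI, rule ccontr)
    let ?S = "filtered_system F g h (\<lambda>z. a * z) G"
    fix t assume t: "t \<in> I" and out: "x t \<notin> \<Psi>"
    \<comment> \<open>Since \<open>h\<close> is nonnegative on \<open>C\<close>, raising the gain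
      only helps. The shift by \<open>k y\<close> passes from inputs of the open loop to corrections
      of the nominal controller.\<close>
    have strict: "\<exists>u. 0 < grad h y \<bullet> (F y + g y *v u) + a * h y" if "0 \<le> h y" for y
    proof -
      obtain u where "0 < grad h y \<bullet> (f y + g y *v u) + a0 * h y"
        using assms(12) \<open>0 \<le> h y\<close> unfolding strict_CBF_def assms(8) a0(2) by blast
      moreover have "F y + g y *v (u - k y) = f y + g y *v u"
        by (simp add: F_def nominal_system_def matrix_vector_mult_diff_distrib)
      moreover have "a0 * h y \<le> a * h y"
        using a \<open>0 \<le> h y\<close> by (intro mult_right_mono) auto
      ultimately show ?thesis
        by (intro exI[of _ "u - k y"]) simp
    qed
    have inC: "x r \<in> C" if "r \<in> I" for r
      using safe_set_invariant[OF assms(7) cF cg assms(11) _ strict x _ that] a a0(1) x0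
      by (auto simp: assms(8))
    have I: "0 \<in> I" "is_interval I" "0 \<le> t"
      using x t unfolding trajectory_on_def by auto
    have sub: "{0..t} \<subseteq> I"
      using I(1,2) t unfolding is_interval_1 by (meson atLeastAtMost_iff subsetI)
    have cx: "continuous_on {0..t} x"
      using trajectory_on_continuous[OF x] sub continuous_on_subset by blast
    obtain s where s: "0 \<le> s" "s < t" "x s \<in> \<Psi>" "\<And>r. s < r \<Longrightarrow> r \<le> t \<Longrightarrow> x r \<notin> \<Psi>"
      using exists_last_time_in_closed[OF cx compact_imp_closed[OF \<open>compact \<Psi>\<close>] _ out I(3)] x0
      by (metis IntD1)
    have cx': "continuous_on {s..t} x"
      using cx s by (auto intro: continuous_on_subset)
    have "x s \<in> ball 0 R'" using s(3) R' by blast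
    then obtain c where c: "s < c" "c \<le> t" "\<And>r. s \<le> r \<Longrightarrow> r \<le> c \<Longrightarrow> x r \<in> ball 0 R'"
      using continuous_stays_in_open[OF cx' s(2) open_ball] by metis
    have far: "x r \<notin> ball 0 R" if "s < r" "r \<le> c" for r
      using s(4)[of r] that c(2) ball\<Psi> by (auto simp: subset_iff)
    \<comment> \<open>The exit point itself must lie in \<open>A\<close>, because the nominal
      segment begins there. Were it in the open ball, the trajectory would remain there briefly,
      against \<open>far\<close>.\<close>
    have "x s \<notin> ball 0 R"
    proof
      assume "x s \<in> ball 0 R"
      moreover have "continuous_on {s..c} x"
        using cx' c by (auto intro: continuous_on_subset)
      ultimately obtain d where "s < d" "d \<le> c" "\<And>r. s \<le> r \<Longrightarrow> r \<le> d \<Longrightarrow> x r \<in> ball 0 R"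
        using continuous_stays_in_open[OF _ c(1) open_ball] by metis
      then show False using far[of d] by auto
    qed
    then have inA: "x r \<in> A" if "s \<le> r" "r \<le> c" for r
      using far[of r] c(3)[of r] that inC[of r] sub c(2) s(1)
      by (cases "r = s") (auto simp: A_def subset_iff)
    have nominal: "?S (x r) = F (x r)" if "s \<le> r" "r \<le> c" for r
    proof (rule filtered_system_eq_nominal[where \<alpha> = "\<lambda>z. a * z", OF assms(11)])
      note hr = hpos[OF inA[OF that]]
      have "- (grad h (x r) \<bullet> F (x r)) / h (x r) \<le> a"
        using M[OF inA[OF that]] a by simp
      then show "0 \<le> grad h (x r) \<bullet> F (x r) + a * h (x r)"
        using hr by (simp add: field_simps)
    qed
    \<comment> \<open>From \<open>s\<close> to \<open>c\<close> the curve solves the nominal system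
      and starts in \<Psi>, so it ends in \<Psi>, against the choice of \<open>s\<close> as last
      time in \<Psi>.\<close>
    have "trajectory_on {0..c - s} F (\<lambda>r. x (s + r))"
      using sub s c by (intro trajectory_on_segment[OF x _ _ s(1) nominal]) (auto simp: subset_iff)
    from closure_reachable_set_invariant[OF lip this] have "x (s + (c - s)) \<in> \<Psi>"
      using s(3) c(1) by (simp add: \<Psi>_def)
    then show False
      using s(4)[of c] c by simp
  qed
  have sub: "\<Phi> \<subseteq> \<Psi>"
    using R ball\<Psi> ball_subset_cball by blast
  show "\<exists>a\<^sub>\<Phi>>0. \<exists>\<Psi>. compact \<Psi> \<and> \<Phi> \<subseteq> \<Psi> \<and>
      (\<forall>a>a\<^sub>\<Phi>.
         forward_invariant_relative C (filtered_system F g h (\<lambda>z. a * z) G) \<Psi> \<and>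
         (\<forall>I x. trajectory_on I (filtered_system F g h (\<lambda>z. a * z) G) x \<and> x 0 \<in> \<Phi> \<inter> C \<longrightarrow>
            bounded (x ` I) \<and> x ` I \<subseteq> \<Psi>))"
  proof (intro exI[of _ "max a0 M"] exI[of _ \<Psi>] conjI allI impI)
    fix a assume a: "max a0 M < a"
    show "forward_invariant_relative C (filtered_system F g h (\<lambda>z. a * z) G) \<Psi>"
      unfolding forward_invariant_relative_def using inv[OF a] by blast
    fix I x
    assume "trajectory_on I (filtered_system F g h (\<lambda>z. a * z) G) x \<and> x 0 \<in> \<Phi> \<inter> C"
    then show "x ` I \<subseteq> \<Psi>"
      using inv[OF a] sub by blast
    then show "bounded (x ` I)"
      using \<open>compact \<Psi>\<close> compact_imp_bounded bounded_subset by blast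
  qed (use a0 \<open>compact \<Psi>\<close> sub in auto)
qed

end
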